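(* For every positive integer $n$, $|B_n(132,213)|=|B_n(213,231)|=|B_n(231,312)|=|B_n(132,312)|$.
   Context: A permutation $\sigma\in S_n$ is written as $\sigma(1)\cdots\sigma(n)$. An index $i\in[n-1]$ is an ascent if $\sigma(i)<\sigma(i+1)$ and a descent if $\sigma(i)>\sigma(i+1)$. A ballot permutation is a permutation such that every prefix $\sigma(1)\cdots\sigma(p)$ has at least as many ascents as descents. $\sigma$ contains a pattern $\pi\in S_k$ if some subsequence $\sigma(c_1)\cdots\sigma(c_k)$ with $c_1<\dots<c_k$ is order-isomorphic to $\pi$, and avoids $\pi$ otherwise. $B_n(\pi_1,\dots,\pi_m)$ denotes the set of ballot permutations of length $n$ avoiding all of $\pi_1,\dots,\pi_m$. Two sets of patterns are called Wilf-equivalent (for ballot permutations) if the corresponding sets $B_n(\cdot)$ have equal cardinality for every $n$. *)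

theory Defs
  imports "HOL-Combinatorics.Multiset_Permutations" "HOL-Library.Sublist"
begin

text \<open>
  A permutation of length n is represented by its one-line word
  \<open>[\<sigma>(1), ..., \<sigma>(n)]\<close>, i.e. an element of \<open>permutations_of_set {1..n}\<close>.
  List positions count from 0, so position \<open>i\<close> below is the index \<open>i + 1\<close> of the word.
\<close>

definition ascents :: "nat list \<Rightarrow> nat set" where
  "ascents xs = {i. Suc i < length xs \<and> xs ! i < xs ! Suc i}"

definition descents :: "nat list \<Rightarrow> nat set" where
  "descents xs = {i. Suc i < length xs \<and> xs ! i > xs ! Suc i}"

definition ballot :: "nat list \<Rightarrow> bool" where
  "ballot xs \<longleftrightarrow> (\<forall>ps. prefix ps xs \<longrightarrow> card (ascents ps) \<ge> card (descents ps))"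

definition order_isomorphic :: "nat list \<Rightarrow> nat list \<Rightarrow> bool" where
  "order_isomorphic xs ys \<longleftrightarrow>
     length xs = length ys \<and>
     (\<forall>i<length xs. \<forall>j<length xs. xs ! i < xs ! j \<longleftrightarrow> ys ! i < ys ! j)"

text \<open>The library's \<open>subseq\<close> is the not necessarily contiguous subsequence relation.\<close>

definition contains_pattern :: "nat list \<Rightarrow> nat list \<Rightarrow> bool" where
  "contains_pattern xs \<pi> \<longleftrightarrow> (\<exists>ys. subseq ys xs \<and> order_isomorphic ys \<pi>)"

definition ballot_avoiders :: "nat \<Rightarrow> nat list set \<Rightarrow> nat list set" where
  "ballot_avoiders n P =
     {\<sigma> \<in> permutations_of_set {1..n}. ballot \<sigma> \<and> (\<forall>\<pi>\<in>P. \<not> contains_pattern \<sigma> \<pi>)}"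

end

theory Submission
  imports Defs
begin

text \<open>
  For positions \<open>i < j < k\<close> of a permutation, consider the three truth values
  \<open>x = (\<sigma>(i) < \<sigma>(j))\<close>, \<open>y = (\<sigma>(j) < \<sigma>(k))\<close>, \<open>z = (\<sigma>(i) < \<sigma>(k))\<close>. Avoiding one of the four pairs of
  patterns means \<open>z = f x y\<close> for all \<open>i < j < k\<close>, where \<open>f\<close> is respectively \<open>x \<and> y\<close>, \<open>x\<close>, \<open>x \<or> y\<close>, \<open>y\<close>. Each of
  these operations is associative and idempotent. Hence all comparisons are obtained by folding \<open>f\<close>
  over the ascent bits of consecutive positions, and conversely every set of ascents yields in this
  way a linear order on the positions (associativity makes the fold consistent, idempotence makes
  it transitive). So in each class every ascent set occurs exactly once, and whether a permutation
  is ballot depends only on its ascent set.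
\<close>

section \<open>Comparisons as folds of ascent bits\<close>

definition governed :: "(bool \<Rightarrow> bool \<Rightarrow> bool) \<Rightarrow> nat list \<Rightarrow> bool" where
  "governed f xs \<longleftrightarrow>
     (\<forall>i j k. i < j \<and> j < k \<and> k < length xs \<longrightarrow>
        (xs ! i < xs ! k) = f (xs ! i < xs ! j) (xs ! j < xs ! k))"

text \<open>For \<open>i < j\<close> this is the left-nested product of \<open>b i\<close>, ...,
  \<open>b (j - 1)\<close>, so the bit at \<open>j\<close> is excluded. Projections have no
  two-sided unit to serve as an empty product, hence the arbitrary value \<open>b i\<close> when
  \<open>j \<le> i\<close>.\<close>

primrec interval_fold :: "('a \<Rightarrow> 'a \<Rightarrow> 'a) \<Rightarrow> (nat \<Rightarrow> 'a) \<Rightarrow> nat \<Rightarrow> nat \<Rightarrow> 'a" where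
  "interval_fold f b i 0 = b i"
| "interval_fold f b i (Suc j) = (if j \<le> i then b i else f (interval_fold f b i j) (b j))"

lemma interval_fold_split:
  assumes assoc: "\<And>x y z. f (f x y) z = f x (f y z)"
    and "i < j" "j < k"
  shows "interval_fold f b i k = f (interval_fold f b i j) (interval_fold f b j k)"
  using \<open>j < k\<close>
proof (induction k)
  case (Suc k)
  show ?case
  proof (cases "k = j")
    case False
    with Suc have "j < k" by simp
    with Suc \<open>i < j\<close> show ?thesis by (simp add: assoc)
  qed (use \<open>i < j\<close> in simp)
qed simp

text \<open>Taking the last position but one as the middle of a triple splits off the final ascent
  bit, which is exactly the recursion of \<open>interval_fold\<close>.\<close>

lemma governed_less_iff:
  assumes "governed f xs" "i < j" "j < length xs"
  shows "xs ! i < xs ! j \<longleftrightarrow> interval_fold f (\<lambda>i. i \<in> ascents xs) i j"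
  using assms(2,3)
proof (induction j)
  case (Suc j)
  have bit: "j \<in> ascents xs \<longleftrightarrow> xs ! j < xs ! Suc j"
    using Suc.prems by (simp add: ascents_def)
  show ?case
  proof (cases "i = j")
    case False
    with Suc.prems have "i < j" by simp
    moreover have "(xs ! i < xs ! Suc j) = f (xs ! i < xs ! j) (xs ! j < xs ! Suc j)"
      using assms(1) \<open>i < j\<close> Suc.prems by (simp add: governed_def)
    ultimately show ?thesis using Suc bit by simp
  qed (use bit in simp)
qed simp

section \<open>Permutations and strict linear orders on positions\<close>

text \<open>Each value below \<open>xs ! i\<close> occupies exactly one position. Hence a
  permutation can be recovered from its comparisons alone.\<close>

lemma permutation_nth_eq_rank:
  assumes "xs \<in> permutations_of_set {1..n}" "i < n"
  shows "xs ! i = Suc (card {j. j < n \<and> xs ! j < xs ! i})"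
proof -
  have xs: "set xs = {1..n}" "distinct xs"
    using assms by (auto simp: permutations_of_set_def)
  have len: "length xs = n"
    using distinct_card[OF xs(2)] xs(1) by simp
  have "xs ! i \<in> {1..n}"
    using xs(1) len assms(2) nth_mem by blast
  have "(!) xs ` {j. j < n \<and> xs ! j < xs ! i} = {v \<in> set xs. v < xs ! i}"
    by (auto simp: in_set_conv_nth len)
  also have "\<dots> = {1..<xs ! i}"
    using \<open>xs ! i \<in> {1..n}\<close> xs(1) by auto
  finally have "card ((!) xs ` {j. j < n \<and> xs ! j < xs ! i}) = xs ! i - 1" by simp
  moreover have "inj_on ((!) xs) {j. j < n \<and> xs ! j < xs ! i}"
    using xs(2) len by (auto simp: inj_on_def nth_eq_iff_index_eq)
  ultimately show ?thesis
    using \<open>xs ! i \<in> {1..n}\<close> by (simp add: card_image)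
qed

lemma permutation_of_strict_order:
  assumes irrefl: "\<And>i. i < n \<Longrightarrow> \<not> L i i"
    and trans: "\<And>i j k. i < n \<Longrightarrow> j < n \<Longrightarrow> k < n \<Longrightarrow> L i j \<Longrightarrow> L j k \<Longrightarrow> L i k"
    and total: "\<And>i j. i < n \<Longrightarrow> j < n \<Longrightarrow> i \<noteq> j \<Longrightarrow> L i j \<or> L j i"
  shows "\<exists>xs \<in> permutations_of_set {1..n}. \<forall>i<n. \<forall>j<n. xs ! i < xs ! j \<longleftrightarrow> L i j"
proof -
  \<comment> \<open>The rank of a position in \<open>L\<close>, shifted so that the least position
    receives the value 1. It is strictly monotone because sets of predecessors are strictly
    nested.\<close>
  define r where "r = (\<lambda>i. Suc (card {j. j < n \<and> L j i}))"
  have mono: "r i < r j" if "i < n" "j < n" "L i j" for i j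
  proof -
    have "{k. k < n \<and> L k i} \<subset> {k. k < n \<and> L k j}"
      using that trans irrefl by blast
    then show ?thesis by (simp add: r_def psubset_card_mono)
  qed
  have iff: "r i < r j \<longleftrightarrow> L i j" if "i < n" "j < n" for i j
    using that mono total by (metis less_asym less_irrefl)
  have inj: "inj_on r {..<n}"
    using mono total by (auto simp: inj_on_def) (metis less_irrefl)
  have "r i \<in> {1..n}" if "i < n" for i
  proof -
    have "{j. j < n \<and> L j i} \<subset> {..<n}" using that irrefl by blast
    then have "card {j. j < n \<and> L j i} < n"
      using psubset_card_mono[of "{..<n}"] by simp
    then show ?thesis by (simp add: r_def)
  qed
  then have "r ` {..<n} = {1..n}"
    using inj by (intro card_subset_eq) (auto simp: card_image)
  then have "map r [0..<n] \<in> permutations_of_set {1..n}"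
    using inj by (simp add: permutations_of_set_def distinct_map atLeast0LessThan)
  then show ?thesis using iff by (intro bexI[of _ "map r [0..<n]"]) auto
qed

section \<open>Governed permutations correspond to ascent sets\<close>

lemma length_permutation: "xs \<in> permutations_of_set {1..n} \<Longrightarrow> length xs = n"
  using length_finite_permutations_of_set by fastforce

text \<open>The ascent set fixes every comparison by \<open>governed_less_iff\<close>, and the
  comparisons fix the ranks, which are the entries.\<close>

lemma inj_on_ascents_governed:
  "inj_on ascents {xs \<in> permutations_of_set {1..n}. governed f xs}"
proof (rule inj_onI, clarify)
  fix xs ys
  assume xs: "xs \<in> permutations_of_set {1..n}" "governed f xs"
    and ys: "ys \<in> permutations_of_set {1..n}" "governed f ys"
    and eq: "ascents xs = ascents ys"
  have len: "length xs = n" "length ys = n"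
    using xs ys by (auto intro: length_permutation)
  have dist: "distinct xs" "distinct ys"
    using xs ys by (auto simp: permutations_of_set_def)
  have lt: "xs ! i < xs ! j \<longleftrightarrow> ys ! i < ys ! j" if "i < j" "j < n" for i j
    using governed_less_iff[OF xs(2)] governed_less_iff[OF ys(2)] that len eq by simp
  have "xs ! i < xs ! j \<longleftrightarrow> ys ! i < ys ! j" if "i < n" "j < n" for i j
  proof (cases i j rule: linorder_cases)
    case greater
    then have "xs ! i \<noteq> xs ! j" "ys ! i \<noteq> ys ! j"
      using that len dist by (simp_all add: nth_eq_iff_index_eq)
    with lt[OF greater] that show ?thesis by (metis linorder_neqE_nat less_asym)
  qed (use lt that in auto)
  then have "{j. j < n \<and> xs ! j < xs ! i} = {j. j < n \<and> ys ! j < ys ! i}" if "i < n" for i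
    using that by auto
  then have "xs ! i = ys ! i" if "i < n" for i
    using permutation_nth_eq_rank[OF xs(1) that] permutation_nth_eq_rank[OF ys(1) that] that
    by simp
  then show "xs = ys" using len by (auto intro: nth_equalityI)
qed

lemma governed_with_ascents:
  assumes assoc: "\<And>x y z. f (f x y) z = f x (f y z)"
    and idem: "\<And>x. f x x = x"
    and "S \<subseteq> {i. Suc i < n}"
  shows "\<exists>xs \<in> permutations_of_set {1..n}. governed f xs \<and> ascents xs = S"
proof -
  define C where "C = interval_fold f (\<lambda>i. i \<in> S)"
  \<comment> \<open>\<open>C\<close> decides pairs taken in increasing order of position; negating
    it for the reversed pairs makes \<open>L\<close> total and antisymmetric.\<close>
  define L where "L = (\<lambda>i j. i < j \<and> C i j \<or> j < i \<and> \<not> C j i)"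
  have split: "C i k = f (C i j) (C j k)" if "i < j" "j < k" for i j k
    unfolding C_def using interval_fold_split[OF assoc that] .
  \<comment> \<open>Together with \<open>neg\<close> this is the classical criterion for inversion
    sets: the chosen pairs and their complement are both transitive. Idempotence enters as
    \<open>f True True = True\<close> and \<open>f False False = False\<close>.\<close>
  have pos: "C i k" if "i < j" "j < k" "C i j" "C j k" for i j k
    using split[OF that(1,2)] that(3,4) idem[of True] by simp
  have neg: "\<not> C i k" if "i < j" "j < k" "\<not> C i j" "\<not> C j k" for i j k
    using split[OF that(1,2)] that(3,4) idem[of False] by simp
  have trans: "L i k" if ijk: "L i j" "L j k" for i j k
  proof -
    consider (up) "i < j" "j < k" "C i j" "C j k" | (down) "k < j" "j < i" "\<not> C k j" "\<not> C j i"
      | (peak) "i < j" "k < j" "C i j" "\<not> C k j" | (valley) "j < i" "j < k" "\<not> C j i" "C j k"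
      using ijk unfolding L_def by blast
    then show ?thesis
    proof cases
      case up
      then show ?thesis using pos[of i j k] by (simp add: L_def)
    next
      case down
      then show ?thesis using neg[of k j i] by (simp add: L_def)
    next
      \<comment> \<open>Here \<open>j\<close> is the rightmost position. If \<open>L i k\<close>
        failed, then \<open>neg\<close> (for \<open>i < k\<close>) or \<open>pos\<close> (for
        \<open>k < i\<close>) would contradict one of the two given bits; \<open>i = k\<close>
        contradicts them directly.\<close>
      case peak
      then show ?thesis using neg[of i k j] pos[of k i j] unfolding L_def by (metis nat_neq_iff)
    next
      case valley
      then show ?thesis using neg[of j i k] pos[of j k i]
        unfolding L_def by (metis nat_neq_iff)
    qed
  qed
  have irrefl: "\<not> L i i" for i by (simp add: L_def)
  have total: "L i j \<or> L j i" if "i \<noteq> j" for i j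
    using that by (auto simp: L_def neq_iff)
  obtain xs where xs: "xs \<in> permutations_of_set {1..n}"
    and lt: "\<And>i j. i < n \<Longrightarrow> j < n \<Longrightarrow> xs ! i < xs ! j \<longleftrightarrow> L i j"
    using permutation_of_strict_order[of n L] irrefl total trans by blast
  have len: "length xs = n" using xs by (rule length_permutation)
  have ltC: "xs ! i < xs ! j \<longleftrightarrow> C i j" if "i < j" "j < n" for i j
    using lt[of i j] that by (auto simp: L_def)
  have "governed f xs"
    using ltC split len by (auto simp: governed_def)
  moreover have "ascents xs = S"
    using ltC len assms(3) by (auto simp: ascents_def C_def)
  ultimately show ?thesis using xs by blast
qed

section \<open>The ballot condition in terms of ascent sets\<close>

text \<open>Distinct entries leave no ties, so within each prefix the descents are the complement of
  the ascents.\<close>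

lemma ballot_iff_ascents:
  assumes "distinct xs"
  shows "ballot xs \<longleftrightarrow>
    (\<forall>p \<le> length xs. card ({i. Suc i < p} - ascents xs) \<le> card ({i. Suc i < p} \<inter> ascents xs))"
proof -
  have asc: "ascents (take p xs) = {i. Suc i < p} \<inter> ascents xs" if "p \<le> length xs" for p
    using that by (auto simp: ascents_def)
  have desc: "descents (take p xs) = {i. Suc i < p} - ascents xs" if "p \<le> length xs" for p
    using that assms
    by (auto simp: ascents_def descents_def nth_eq_iff_index_eq not_less le_less)
  have "ballot xs \<longleftrightarrow>
    (\<forall>p \<le> length xs. card (descents (take p xs)) \<le> card (ascents (take p xs)))"
    unfolding ballot_def
  proof safe
    fix ps assume *: "\<forall>p \<le> length xs. card (descents (take p xs)) \<le> card (ascents (take p xs))"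
      and "prefix ps xs"
    then have "ps = take (length ps) xs" "length ps \<le> length xs"
      by (auto simp: prefix_def)
    with * show "card (descents ps) \<le> card (ascents ps)" by metis
  qed (use take_is_prefix in blast)
  then show ?thesis using asc desc by simp
qed

text \<open>The right-hand side is free of \<open>f\<close>; this is what makes the four counts
  agree. The bijection is \<open>ascents\<close> itself.\<close>

lemma card_ballot_governed:
  assumes assoc: "\<And>x y z. f (f x y) z = f x (f y z)"
    and idem: "\<And>x. f x x = x"
  shows "card {xs \<in> permutations_of_set {1..n}. ballot xs \<and> governed f xs} =
    card {S. S \<subseteq> {i. Suc i < n} \<and>
      (\<forall>p \<le> n. card ({i. Suc i < p} - S) \<le> card ({i. Suc i < p} \<inter> S))}"
    (is "card ?A = card ?B")
proof -
  have ballot: "ballot xs \<longleftrightarrow>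
      (\<forall>p \<le> n. card ({i. Suc i < p} - ascents xs) \<le> card ({i. Suc i < p} \<inter> ascents xs))"
    if "xs \<in> permutations_of_set {1..n}" for xs
    using ballot_iff_ascents[of xs] length_permutation[OF that] that
    by (simp add: permutations_of_set_def)
  have "ascents ` ?A = ?B"
  proof
    show "ascents ` ?A \<subseteq> ?B"
    proof clarify
      fix xs assume xs: "xs \<in> permutations_of_set {1..n}" "ballot xs"
      then have "ascents xs \<subseteq> {i. Suc i < n}"
        using length_permutation by (auto simp: ascents_def)
      with xs ballot show "ascents xs \<subseteq> {i. Suc i < n} \<and>
          (\<forall>p \<le> n. card ({i. Suc i < p} - ascents xs) \<le> card ({i. Suc i < p} \<inter> ascents xs))"
        by blast
    qed
    show "?B \<subseteq> ascents ` ?A"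
    proof
      fix S assume S: "S \<in> ?B"
      then obtain xs where "xs \<in> permutations_of_set {1..n}" "governed f xs" "ascents xs = S"
        using governed_with_ascents[OF assoc idem, of S n] by blast
      with S ballot show "S \<in> ascents ` ?A" by blast
    qed
  qed
  moreover have "inj_on ascents ?A"
    by (rule inj_on_subset[OF inj_on_ascents_governed]) auto
  ultimately show ?thesis using card_image[of ascents ?A] by argo
qed

section \<open>Patterns of length three\<close>

lemma subseq_triple_iff:
  "subseq [a, b, c] xs \<longleftrightarrow>
     (\<exists>i j k. i < j \<and> j < k \<and> k < length xs \<and> xs ! i = a \<and> xs ! j = b \<and> xs ! k = c)"
  (is "_ \<longleftrightarrow> ?R")
proof
  assume "subseq [a, b, c] xs"
  then obtain us vs where 1: "xs = us @ a # vs" "subseq [b, c] vs"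
    by (blast dest: list_emb_ConsD)
  then obtain us' vs' where 2: "vs = us' @ b # vs'" "subseq [c] vs'"
    by (blast dest: list_emb_ConsD)
  then obtain us'' vs'' where 3: "vs' = us'' @ c # vs''"
    by (blast dest: list_emb_ConsD)
  show ?R
    by (rule exI[of _ "length us"], rule exI[of _ "length us + Suc (length us')"],
        rule exI[of _ "length us + Suc (length us' + Suc (length us''))"])
      (simp add: 1 2 3 nth_append)
next
  assume ?R
  then obtain i j k where ijk: "i < j" "j < k" "k < length xs"
    and eq: "xs ! i = a" "xs ! j = b" "xs ! k = c" by blast
  have c: "subseq [c] (drop (Suc j) xs)"
    using ijk eq nth_mem[of "k - Suc j" "drop (Suc j) xs"] by (simp add: subseq_singleton_left)
  have "drop (Suc i) xs = take (j - Suc i) (drop (Suc i) xs) @ b # drop (Suc j) xs"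
    using ijk eq id_take_nth_drop[of "j - Suc i" "drop (Suc i) xs"] by simp
  then have bc: "subseq [b, c] (drop (Suc i) xs)"
    using c by (metis list_emb_append2 subseq_Cons2)
  have "xs = take i xs @ a # drop (Suc i) xs"
    using ijk eq id_take_nth_drop[of i xs] by simp
  then show "subseq [a, b, c] xs"
    using bc by (metis list_emb_append2 subseq_Cons2)
qed

lemma contains_pattern_triple_iff:
  "contains_pattern xs [a, b, c] \<longleftrightarrow>
     (\<exists>i j k. i < j \<and> j < k \<and> k < length xs \<and>
        order_isomorphic [xs ! i, xs ! j, xs ! k] [a, b, c])"
proof -
  have "\<exists>x y z. ys = [x, y, z]" if "order_isomorphic ys [a, b, c]" for ys
    using that by (auto simp: order_isomorphic_def length_Suc_conv)
  then have "contains_pattern xs [a, b, c] \<longleftrightarrow>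
      (\<exists>x y z. subseq [x, y, z] xs \<and> order_isomorphic [x, y, z] [a, b, c])"
    unfolding contains_pattern_def by blast
  then show ?thesis unfolding subseq_triple_iff by blast
qed

lemma order_isomorphic_triple_iff:
  "order_isomorphic [x, y, z] [a, b, c] \<longleftrightarrow>
     (x < y \<longleftrightarrow> a < b) \<and> (y < x \<longleftrightarrow> b < a) \<and> (y < z \<longleftrightarrow> b < c) \<and> (z < y \<longleftrightarrow> c < b) \<and>
     (x < z \<longleftrightarrow> a < c) \<and> (z < x \<longleftrightarrow> c < a)"
  by (simp add: order_isomorphic_def All_less_Suc) blast

text \<open>Reduces avoidance of two patterns to a finite check on the relative order of three
  distinct numbers.\<close>

lemma ballot_avoiders_eq_governed:
  assumes "\<And>x y z :: nat. x \<noteq> y \<Longrightarrow> y \<noteq> z \<Longrightarrow> x \<noteq> z \<Longrightarrow>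
    \<not> order_isomorphic [x, y, z] [a, b, c] \<and> \<not> order_isomorphic [x, y, z] [a', b', c'] \<longleftrightarrow>
    (x < z) = f (x < y) (y < z)"
  shows "ballot_avoiders n {[a, b, c], [a', b', c']} =
    {xs \<in> permutations_of_set {1..n}. ballot xs \<and> governed f xs}"
proof -
  have "\<not> contains_pattern xs [a, b, c] \<and> \<not> contains_pattern xs [a', b', c'] \<longleftrightarrow> governed f xs"
    if "xs \<in> permutations_of_set {1..n}" for xs
  proof -
    have "distinct xs" using that by (simp add: permutations_of_set_def)
    then have ne: "xs ! i \<noteq> xs ! j \<and> xs ! j \<noteq> xs ! k \<and> xs ! i \<noteq> xs ! k"
      if "i < j" "j < k" "k < length xs" for i j k
      using that by (simp add: nth_eq_iff_index_eq)
    have "\<not> order_isomorphic [xs ! i, xs ! j, xs ! k] [a, b, c] \<and>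
        \<not> order_isomorphic [xs ! i, xs ! j, xs ! k] [a', b', c'] \<longleftrightarrow>
        (xs ! i < xs ! k) = f (xs ! i < xs ! j) (xs ! j < xs ! k)"
      if "i < j" "j < k" "k < length xs" for i j k
      using ne[OF that] assms by blast
    then show ?thesis
      unfolding contains_pattern_triple_iff governed_def by blast
  qed
  then show ?thesis unfolding ballot_avoiders_def by auto
qed

theorem theorem3p4:
  fixes n :: nat
  assumes "n \<ge> 1"
  shows "card (ballot_avoiders n {[1,3,2], [2,1,3]}) = card (ballot_avoiders n {[2,1,3], [2,3,1]})
       \<and> card (ballot_avoiders n {[2,1,3], [2,3,1]}) = card (ballot_avoiders n {[2,3,1], [3,1,2]})
       \<and> card (ballot_avoiders n {[2,3,1], [3,1,2]}) = card (ballot_avoiders n {[1,3,2], [3,1,2]})"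
proof -
  let ?G = "\<lambda>f. {xs \<in> permutations_of_set {1..n}. ballot xs \<and> governed f xs}"
  \<comment> \<open>With bits \<open>x < y\<close> and \<open>y < z\<close>, the patterns 132 and
    231 are those with bits true, false, and 213 and 312 those with bits false, true. Each pair
    forbids one pattern of each kind, which fixes \<open>f\<close> on unequal bits; on equal bits
    transitivity forces the outcome.\<close>
  have "ballot_avoiders n {[1,3,2], [2,1,3]} = ?G (\<lambda>x y. x \<and> y)"
    by (rule ballot_avoiders_eq_governed) (auto simp: order_isomorphic_triple_iff)
  moreover have "ballot_avoiders n {[2,1,3], [2,3,1]} = ?G (\<lambda>x y. x)"
    by (rule ballot_avoiders_eq_governed) (auto simp: order_isomorphic_triple_iff)
  moreover have "ballot_avoiders n {[2,3,1], [3,1,2]} = ?G (\<lambda>x y. x \<or> y)"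
    by (rule ballot_avoiders_eq_governed) (auto simp: order_isomorphic_triple_iff)
  moreover have "ballot_avoiders n {[1,3,2], [3,1,2]} = ?G (\<lambda>x y. y)"
    by (rule ballot_avoiders_eq_governed) (auto simp: order_isomorphic_triple_iff)
  moreover have "card (?G f) = card (?G g)"
    if "\<And>x y z. f (f x y) z = f x (f y z)" "\<And>x. f x x = x"
      "\<And>x y z. g (g x y) z = g x (g y z)" "\<And>x. g x x = x" for f g
    using card_ballot_governed[OF that(1,2)] card_ballot_governed[OF that(3,4)] by simp
  ultimately show ?thesis by presburger
qed

end
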